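(* Let $n$ be a natural number. The assignment $$T_i\mapsto s_i,\qquad E_i\mapsto e_i:=\tfrac12(1+t_it_{i+1})\qquad(1\le i\le n-1)$$ defines a morphism of algebras $\psi:\mathcal{E}_n(1)\to\mathbb{C}W_n$.
   Context: $\mathcal{E}_n(1)$ is the specialization at $u=1$ of the algebra of braids and ties: it is the associative unital $\mathbb{C}$-algebra with generators $1,T_1,\ldots,T_{n-1},E_1,\ldots,E_{n-1}$ and relations (all indices in $\{1,\ldots,n-1\}$): - $T_iT_j=T_jT_i$ if $|i-j|>1$; - $T_iT_jT_i=T_jT_iT_j$ if $|i-j|=1$; - $E_i^2=E_i$; - $E_iE_j=E_jE_i$ for all $i,j$; - $E_iT_i=T_iE_i$; - $E_iT_j=T_jE_i$ if $|i-j|>1$; - $E_jT_iT_j=T_iT_jE_i$ if $|i-j|=1$; - $E_iE_jT_j=E_iT_jE_i=T_jE_iE_j$ if $|i-j|=1$; - $T_i^2=1$. $W_n=C_2\wr\mathcal{S}_n=C\rtimes\mathcal{S}_n$ is the hyperoctahedral group, where $C_2=\{1,t\}$ is the group with two elements and $C=C_2\times\cdots\times C_2$ ($n$ times). The $s_i=(i,i+1)\in\mathcal{S}_n$ are the elementary transpositions. The elements $t_i\in C$ are defined by $t_1=t$ (the generator of the first factor) and $t_{i+1}=s_it_is_i$; thus, viewing $W_n$ as monomial matrices with non-zero entries $1$ or $t$, $t_i$ is the diagonal matrix with $t$ in position $(i,i)$ and $1$ in the other diagonal positions. $\mathbb{C}W_n$ is the group algebra. *)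

theory Defs
  imports "HOL-Algebra.Algebra" "HOL-Algebra.Algebraic_Closure_Type"
begin

section \<open>Associative unital algebras and their morphisms\<close>

text \<open>The locale \<^locale>\<open>algebra\<close> of the library is restricted to commutative algebras.\<close>

locale assoc_algebra = module + ring M +
  assumes smult_mult_left:
    "\<lbrakk>a \<in> carrier R; x \<in> carrier M; y \<in> carrier M\<rbrakk> \<Longrightarrow>
      (a \<odot>\<^bsub>M\<^esub> x) \<otimes>\<^bsub>M\<^esub> y = a \<odot>\<^bsub>M\<^esub> (x \<otimes>\<^bsub>M\<^esub> y)"
  and smult_mult_right:
    "\<lbrakk>a \<in> carrier R; x \<in> carrier M; y \<in> carrier M\<rbrakk> \<Longrightarrow>
      x \<otimes>\<^bsub>M\<^esub> (a \<odot>\<^bsub>M\<^esub> y) = a \<odot>\<^bsub>M\<^esub> (x \<otimes>\<^bsub>M\<^esub> y)"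

locale assoc_algebra_hom = A: assoc_algebra R A + B: assoc_algebra R B
  for R (structure) and A (structure) and B (structure) +
  fixes h
  assumes ring_hom: "h \<in> ring_hom A B"
    and smult_hom: "\<lbrakk>a \<in> carrier R; x \<in> carrier A\<rbrakk> \<Longrightarrow> h (a \<odot>\<^bsub>A\<^esub> x) = a \<odot>\<^bsub>B\<^esub> h x"

abbreviation complex_field :: "complex ring" where
  "complex_field \<equiv> ring_of_type_algebra"

section \<open>Monoid algebras over the complex numbers\<close>

definition supp :: "('g \<Rightarrow> complex) \<Rightarrow> 'g set" where
  "supp f = {x. f x \<noteq> 0}"

definition single :: "'g \<Rightarrow> 'g \<Rightarrow> complex" where
  "single x = (\<lambda>y. if y = x then 1 else 0)"

text \<open>An element is the finitely supported family of its coefficients; the product is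
  convolution, so that \<open>single x * single y = single (x \<otimes> y)\<close>.\<close>

definition monoid_algebra :: "('g, 'z) monoid_scheme \<Rightarrow> (complex, 'g \<Rightarrow> complex) module" where
  "monoid_algebra G = \<lparr>
     carrier = {f. finite (supp f) \<and> supp f \<subseteq> carrier G},
     monoid.mult = (\<lambda>f g x. \<Sum>a\<in>supp f. \<Sum>b\<in>supp g. if a \<otimes>\<^bsub>G\<^esub> b = x then f a * g b else 0),
     monoid.one = single \<one>\<^bsub>G\<^esub>,
     ring.zero = (\<lambda>x. 0),
     ring.add = (\<lambda>f g x. f x + g x),
     module.smult = (\<lambda>c f x. c * f x)\<rparr>"

section \<open>Algebras given by generators and relations\<close>

definition free_monoid :: "'x set \<Rightarrow> 'x list monoid" where
  "free_monoid S = \<lparr>carrier = lists S, monoid.mult = (@), monoid.one = []\<rparr>"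

abbreviation free_algebra :: "'x set \<Rightarrow> (complex, 'x list \<Rightarrow> complex) module" where
  "free_algebra S \<equiv> monoid_algebra (free_monoid S)"

text \<open>The scalar multiplication on cosets follows the pattern of \<^const>\<open>rcoset_mult\<close>: the union
  collects one and the same coset for all representatives.\<close>

definition quotient_algebra ::
    "('k, 'a, 'z) module_scheme \<Rightarrow> 'a set \<Rightarrow> ('k, 'a set) module" where
  "quotient_algebra A I = ring.extend (A Quot I)
     (module.fields (\<lambda>c K. \<Union>x\<in>K. I +>\<^bsub>A\<^esub> (c \<odot>\<^bsub>A\<^esub> x)))"

text \<open>All relations considered here equate two words in the generators.\<close>

definition relation_ideal :: "'x set \<Rightarrow> ('x list \<times> 'x list) set \<Rightarrow> ('x list \<Rightarrow> complex) set" where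
  "relation_ideal S r =
     Idl\<^bsub>free_algebra S\<^esub> {single u \<ominus>\<^bsub>free_algebra S\<^esub> single v | u v. (u, v) \<in> r}"

definition presented_algebra ::
    "'x set \<Rightarrow> ('x list \<times> 'x list) set \<Rightarrow> (complex, ('x list \<Rightarrow> complex) set) module" where
  "presented_algebra S r = quotient_algebra (free_algebra S) (relation_ideal S r)"

definition presented_gen ::
    "'x set \<Rightarrow> ('x list \<times> 'x list) set \<Rightarrow> 'x \<Rightarrow> ('x list \<Rightarrow> complex) set" where
  "presented_gen S r x = relation_ideal S r +>\<^bsub>free_algebra S\<^esub> single [x]"

section \<open>The algebra of braids and ties at \<open>u = 1\<close>\<close>

datatype bt_gen = T nat | E nat

definition bt_gens :: "nat \<Rightarrow> bt_gen set" where
  "bt_gens n = T ` {1..<n} \<union> E ` {1..<n}"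

abbreviation far :: "nat \<Rightarrow> nat \<Rightarrow> bool" where
  "far i j \<equiv> \<bar>int i - int j\<bar> > 1"

abbreviation adjacent :: "nat \<Rightarrow> nat \<Rightarrow> bool" where
  "adjacent i j \<equiv> \<bar>int i - int j\<bar> = 1"

inductive_set bt_relations :: "nat \<Rightarrow> (bt_gen list \<times> bt_gen list) set" for n where
  TT_far: "\<lbrakk>i \<in> {1..<n}; j \<in> {1..<n}; far i j\<rbrakk> \<Longrightarrow> ([T i, T j], [T j, T i]) \<in> bt_relations n"
| TTT: "\<lbrakk>i \<in> {1..<n}; j \<in> {1..<n}; adjacent i j\<rbrakk> \<Longrightarrow>
    ([T i, T j, T i], [T j, T i, T j]) \<in> bt_relations n"
| EE_idem: "i \<in> {1..<n} \<Longrightarrow> ([E i, E i], [E i]) \<in> bt_relations n"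
| EE: "\<lbrakk>i \<in> {1..<n}; j \<in> {1..<n}\<rbrakk> \<Longrightarrow> ([E i, E j], [E j, E i]) \<in> bt_relations n"
| ET: "i \<in> {1..<n} \<Longrightarrow> ([E i, T i], [T i, E i]) \<in> bt_relations n"
| ET_far: "\<lbrakk>i \<in> {1..<n}; j \<in> {1..<n}; far i j\<rbrakk> \<Longrightarrow> ([E i, T j], [T j, E i]) \<in> bt_relations n"
| ETT: "\<lbrakk>i \<in> {1..<n}; j \<in> {1..<n}; adjacent i j\<rbrakk> \<Longrightarrow>
    ([E j, T i, T j], [T i, T j, E i]) \<in> bt_relations n"
| EET_ETE: "\<lbrakk>i \<in> {1..<n}; j \<in> {1..<n}; adjacent i j\<rbrakk> \<Longrightarrow>
    ([E i, E j, T j], [E i, T j, E i]) \<in> bt_relations n"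
| ETE_TEE: "\<lbrakk>i \<in> {1..<n}; j \<in> {1..<n}; adjacent i j\<rbrakk> \<Longrightarrow>
    ([E i, T j, E i], [T j, E i, E j]) \<in> bt_relations n"
| TT: "i \<in> {1..<n} \<Longrightarrow> ([T i, T i], []) \<in> bt_relations n"

definition bt_algebra :: "nat \<Rightarrow> (complex, (bt_gen list \<Rightarrow> complex) set) module" where
  "bt_algebra n = presented_algebra (bt_gens n) (bt_relations n)"

definition bt_T :: "nat \<Rightarrow> nat \<Rightarrow> (bt_gen list \<Rightarrow> complex) set" where
  "bt_T n i = presented_gen (bt_gens n) (bt_relations n) (T i)"

definition bt_E :: "nat \<Rightarrow> nat \<Rightarrow> (bt_gen list \<Rightarrow> complex) set" where
  "bt_E n i = presented_gen (bt_gens n) (bt_relations n) (E i)"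

section \<open>The hyperoctahedral group\<close>

definition semidirect_product ::
    "('a, 'y) monoid_scheme \<Rightarrow> ('b, 'z) monoid_scheme \<Rightarrow> ('b \<Rightarrow> 'a \<Rightarrow> 'a) \<Rightarrow> ('a \<times> 'b) monoid" where
  "semidirect_product N H \<phi> = \<lparr>
     carrier = carrier N \<times> carrier H,
     monoid.mult = (\<lambda>(x, g) (y, h). (x \<otimes>\<^bsub>N\<^esub> \<phi> g y, g \<otimes>\<^bsub>H\<^esub> h)),
     monoid.one = (\<one>\<^bsub>N\<^esub>, \<one>\<^bsub>H\<^esub>)\<rparr>"

text \<open>The group \<open>{1, t}\<close> is written additively, with \<open>t\<close> the residue class \<open>1\<close> modulo \<open>2\<close>.\<close>

definition C_group :: "nat \<Rightarrow> (nat \<Rightarrow> int) monoid" where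
  "C_group n = product_group {1..n} (\<lambda>_. integer_mod_group 2)"

text \<open>The pair \<open>(c, \<sigma>)\<close> is the monomial matrix with entry \<open>c i\<close> in row \<open>i\<close>, column
  \<open>\<sigma>\<^sup>-\<^sup>1 i\<close>; conjugating a diagonal matrix by \<open>\<sigma>\<close> thus moves the entry at \<open>i\<close> to \<open>\<sigma> i\<close>.\<close>

definition hyp_group :: "nat \<Rightarrow> ((nat \<Rightarrow> int) \<times> (nat \<Rightarrow> nat)) monoid" where
  "hyp_group n = semidirect_product (C_group n) (sym_group n)
     (\<lambda>\<sigma> c. \<lambda>i\<in>{1..n}. c (inv' \<sigma> i))"

definition hyp_s :: "nat \<Rightarrow> nat \<Rightarrow> (nat \<Rightarrow> int) \<times> (nat \<Rightarrow> nat)" where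
  "hyp_s n i = (\<one>\<^bsub>C_group n\<^esub>, Transposition.transpose i (Suc i))"

text \<open>The value at \<open>0\<close> is irrelevant.\<close>

fun hyp_t :: "nat \<Rightarrow> nat \<Rightarrow> (nat \<Rightarrow> int) \<times> (nat \<Rightarrow> nat)" where
  "hyp_t n 0 = undefined"
| "hyp_t n (Suc 0) = (\<lambda>i\<in>{1..n}. if i = 1 then 1 else 0, id)"
| "hyp_t n (Suc (Suc i)) =
     hyp_s n (Suc i) \<otimes>\<^bsub>hyp_group n\<^esub> hyp_t n (Suc i) \<otimes>\<^bsub>hyp_group n\<^esub> hyp_s n (Suc i)"

lemma hyp_t_eq:
  assumes "i \<in> {1..n}"
  shows "hyp_t n i = (\<lambda>k\<in>{1..n}. if k = i then 1 else 0, id)"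
  using assms
proof (induction i rule: hyp_t.induct)
  case (3 n i)
  let ?s = "Transposition.transpose (Suc i) (Suc (Suc i))"
  have s: "inv' ?s = ?s" by simp
  have IH: "hyp_t n (Suc i) = (\<lambda>k\<in>{1..n}. if k = Suc i then 1 else 0, id)"
    by (rule 3) (use 3 in simp)
  show ?case
    using 3(2) unfolding hyp_t.simps IH
    by (auto simp: hyp_s_def hyp_group_def semidirect_product_def C_group_def sym_group_def s
        transpose_def restrict_def fun_eq_iff)
qed auto

definition hyp_algebra ::
    "nat \<Rightarrow> (complex, (nat \<Rightarrow> int) \<times> (nat \<Rightarrow> nat) \<Rightarrow> complex) module" where
  "hyp_algebra n = monoid_algebra (hyp_group n)"

definition hyp_e :: "nat \<Rightarrow> nat \<Rightarrow> (nat \<Rightarrow> int) \<times> (nat \<Rightarrow> nat) \<Rightarrow> complex" where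
  "hyp_e n i = (1 / 2) \<odot>\<^bsub>hyp_algebra n\<^esub>
     (\<one>\<^bsub>hyp_algebra n\<^esub> \<oplus>\<^bsub>hyp_algebra n\<^esub>
       single (hyp_t n i \<otimes>\<^bsub>hyp_group n\<^esub> hyp_t n (Suc i)))"

end

theory Submission
  imports Defs
begin

text \<open>An algebra given by generators and relations maps to an algebra \<open>B\<close>, by exactly one
  morphism, whenever elements of \<open>B\<close> are chosen for the generators and satisfy the relations: the
  choice extends multiplicatively to words, linearly to the free algebra, and then descends to the
  quotient because its kernel contains the relations. This is \<open>presented_algebra_universal\<close>. It rests
  on two general constructions: the linear extension of a monoid morphism to the monoid algebra
  (\<open>extend_monoid_hom\<close>) and the factorization of a morphism through a quotient
  (\<open>factor_through_quotient\<close>). Uniqueness holds because words span the free algebra.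

  It remains to see that the \<open>s\<^sub>i\<close> and \<open>e\<^sub>i\<close> satisfy the relations of braids and ties. It is convenient
  to put \<open>e\<^sub>i\<^sub>j = (1 + t\<^sub>i t\<^sub>j) / 2\<close> for arbitrary \<open>i \<noteq> j\<close>, so that \<open>e\<^sub>i\<close> is \<open>e\<^sub>i\<^sub>j\<close> with \<open>j = i + 1\<close>. Then
  every relation follows from three facts. A permutation moves the indices,
  \<open>\<sigma> e\<^sub>i\<^sub>j = e\<^sub>\<sigma>\<^sub>i\<^sub>\<sigma>\<^sub>j \<sigma>\<close> (\<open>hyp_alg_perm_tie\<close>). The \<open>e\<^sub>i\<^sub>j\<close> are commuting idempotents, since the \<open>t\<^sub>i t\<^sub>j\<close>
  are commuting involutions. Finally \<open>e\<^sub>i\<^sub>j e\<^sub>i\<^sub>k = e\<^sub>i\<^sub>j e\<^sub>j\<^sub>k\<close> (\<open>hyp_tie_absorb\<close>), since multiplication by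
  \<open>t\<^sub>i t\<^sub>j\<close> exchanges \<open>t\<^sub>i t\<^sub>k\<close> and \<open>t\<^sub>j t\<^sub>k\<close> and is absorbed by \<open>e\<^sub>i\<^sub>j\<close>. The relations among the \<open>s\<^sub>i\<close> are
  those of the symmetric group.\<close>

section \<open>Associative algebras\<close>

lemma complex_field_simps [simp]:
  "carrier complex_field = UNIV" "\<zero>\<^bsub>complex_field\<^esub> = 0" "\<one>\<^bsub>complex_field\<^esub> = 1"
  "x \<oplus>\<^bsub>complex_field\<^esub> y = x + y" "x \<otimes>\<^bsub>complex_field\<^esub> y = x * y"
  by (simp_all add: ring_of_type_algebra_def)

lemma assoc_algebraI:
  assumes "cring R" "ring A"
    and "\<And>a x. \<lbrakk>a \<in> carrier R; x \<in> carrier A\<rbrakk> \<Longrightarrow> a \<odot>\<^bsub>A\<^esub> x \<in> carrier A"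
    and "\<And>a b x. \<lbrakk>a \<in> carrier R; b \<in> carrier R; x \<in> carrier A\<rbrakk> \<Longrightarrow>
      (a \<oplus>\<^bsub>R\<^esub> b) \<odot>\<^bsub>A\<^esub> x = (a \<odot>\<^bsub>A\<^esub> x) \<oplus>\<^bsub>A\<^esub> (b \<odot>\<^bsub>A\<^esub> x)"
    and "\<And>a x y. \<lbrakk>a \<in> carrier R; x \<in> carrier A; y \<in> carrier A\<rbrakk> \<Longrightarrow>
      a \<odot>\<^bsub>A\<^esub> (x \<oplus>\<^bsub>A\<^esub> y) = (a \<odot>\<^bsub>A\<^esub> x) \<oplus>\<^bsub>A\<^esub> (a \<odot>\<^bsub>A\<^esub> y)"
    and "\<And>a b x. \<lbrakk>a \<in> carrier R; b \<in> carrier R; x \<in> carrier A\<rbrakk> \<Longrightarrow>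
      (a \<otimes>\<^bsub>R\<^esub> b) \<odot>\<^bsub>A\<^esub> x = a \<odot>\<^bsub>A\<^esub> (b \<odot>\<^bsub>A\<^esub> x)"
    and "\<And>x. x \<in> carrier A \<Longrightarrow> \<one>\<^bsub>R\<^esub> \<odot>\<^bsub>A\<^esub> x = x"
    and "\<And>a x y. \<lbrakk>a \<in> carrier R; x \<in> carrier A; y \<in> carrier A\<rbrakk> \<Longrightarrow>
      (a \<odot>\<^bsub>A\<^esub> x) \<otimes>\<^bsub>A\<^esub> y = a \<odot>\<^bsub>A\<^esub> (x \<otimes>\<^bsub>A\<^esub> y)"
    and "\<And>a x y. \<lbrakk>a \<in> carrier R; x \<in> carrier A; y \<in> carrier A\<rbrakk> \<Longrightarrow>
      x \<otimes>\<^bsub>A\<^esub> (a \<odot>\<^bsub>A\<^esub> y) = a \<odot>\<^bsub>A\<^esub> (x \<otimes>\<^bsub>A\<^esub> y)"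
  shows "assoc_algebra R A"
  using assms by (intro assoc_algebra.intro moduleI assoc_algebra_axioms.intro) (auto simp: ring_def)

context assoc_algebra_hom
begin

lemma hom_closed: "x \<in> carrier A \<Longrightarrow> h x \<in> carrier B"
  and hom_mult: "\<lbrakk>x \<in> carrier A; y \<in> carrier A\<rbrakk> \<Longrightarrow> h (x \<otimes>\<^bsub>A\<^esub> y) = h x \<otimes>\<^bsub>B\<^esub> h y"
  and hom_add: "\<lbrakk>x \<in> carrier A; y \<in> carrier A\<rbrakk> \<Longrightarrow> h (x \<oplus>\<^bsub>A\<^esub> y) = h x \<oplus>\<^bsub>B\<^esub> h y"
  and hom_one: "h \<one>\<^bsub>A\<^esub> = \<one>\<^bsub>B\<^esub>"
  using ring_hom by (auto simp: ring_hom_def)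

end

lemma assoc_algebra_hom_compose:
  assumes "assoc_algebra_hom R A B h" "assoc_algebra_hom R B C k"
  shows "assoc_algebra_hom R A C (\<lambda>x. k (h x))"
proof -
  interpret h: assoc_algebra_hom R A B h by fact
  interpret k: assoc_algebra_hom R B C k by fact
  show ?thesis
    by unfold_locales
      (auto simp: ring_hom_def h.hom_closed h.hom_mult h.hom_add h.hom_one h.smult_hom
        k.hom_closed k.hom_mult k.hom_add k.hom_one k.smult_hom)
qed

section \<open>Quotients of associative algebras\<close>

lemma quotient_algebra_simps:
  "carrier (quotient_algebra A I) = a_rcosets\<^bsub>A\<^esub> I"
  "monoid.mult (quotient_algebra A I) = rcoset_mult A I"
  "\<one>\<^bsub>quotient_algebra A I\<^esub> = I +>\<^bsub>A\<^esub> \<one>\<^bsub>A\<^esub>"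
  "\<zero>\<^bsub>quotient_algebra A I\<^esub> = I"
  "ring.add (quotient_algebra A I) = set_add A"
  "c \<odot>\<^bsub>quotient_algebra A I\<^esub> K = (\<Union>x\<in>K. I +>\<^bsub>A\<^esub> (c \<odot>\<^bsub>A\<^esub> x))"
  by (simp_all add: quotient_algebra_def FactRing_def ring.defs module.defs)

locale algebra_ideal = assoc_algebra R A + ideal I A for R and A and I
begin

lemma carrier_quotient: "carrier (quotient_algebra A I) = (\<lambda>x. I +>\<^bsub>A\<^esub> x) ` carrier A"
  by (auto simp: quotient_algebra_simps A_RCOSETS_def')

text \<open>An ideal absorbs scalars because \<open>c x = (c 1) x\<close>; this is why the union that defines the
  scalar product of a coset is a single coset.\<close>

lemma smult_coset:
  assumes c: "c \<in> carrier R" and x: "x \<in> carrier A"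
  shows "c \<odot>\<^bsub>quotient_algebra A I\<^esub> (I +>\<^bsub>A\<^esub> x) = I +>\<^bsub>A\<^esub> (c \<odot>\<^bsub>A\<^esub> x)"
proof -
  have absorb: "c \<odot>\<^bsub>A\<^esub> i \<in> I" if "i \<in> I" for i
    using smult_mult_left[OF c one_closed, of i] I_l_closed[OF that, of "c \<odot>\<^bsub>A\<^esub> \<one>\<^bsub>A\<^esub>"] c that by simp
  have "I +>\<^bsub>A\<^esub> (c \<odot>\<^bsub>A\<^esub> y) = I +>\<^bsub>A\<^esub> (c \<odot>\<^bsub>A\<^esub> x)" if y: "y \<in> I +>\<^bsub>A\<^esub> x" for y
  proof -
    obtain i where i: "i \<in> I" "y = i \<oplus>\<^bsub>A\<^esub> x"
      using y by (auto simp: a_r_coset_def r_coset_def)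
    have "c \<odot>\<^bsub>A\<^esub> y = c \<odot>\<^bsub>A\<^esub> i \<oplus>\<^bsub>A\<^esub> c \<odot>\<^bsub>A\<^esub> x"
      using i c x by (simp add: smult_r_distr)
    then show ?thesis
      using absorb[OF i(1)] c x i
      by (metis a_repr_independence' a_rcosI a_subset smult_closed)
  qed
  then show ?thesis
    using a_rcos_self[OF x] unfolding quotient_algebra_simps(6) by blast
qed

lemma mult_coset: "\<lbrakk>x \<in> carrier A; y \<in> carrier A\<rbrakk> \<Longrightarrow>
    (I +>\<^bsub>A\<^esub> x) \<otimes>\<^bsub>quotient_algebra A I\<^esub> (I +>\<^bsub>A\<^esub> y) = I +>\<^bsub>A\<^esub> (x \<otimes>\<^bsub>A\<^esub> y)"
  and add_coset: "\<lbrakk>x \<in> carrier A; y \<in> carrier A\<rbrakk> \<Longrightarrow>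
    (I +>\<^bsub>A\<^esub> x) \<oplus>\<^bsub>quotient_algebra A I\<^esub> (I +>\<^bsub>A\<^esub> y) = I +>\<^bsub>A\<^esub> (x \<oplus>\<^bsub>A\<^esub> y)"
  by (simp_all add: quotient_algebra_simps rcoset_mult_add a_rcos_sum)

lemmas coset_simps = smult_coset mult_coset add_coset

lemma ring_quotient: "ring (quotient_algebra A I)"
proof (rule ringI)
  have zero: "\<zero>\<^bsub>quotient_algebra A I\<^esub> = I +>\<^bsub>A\<^esub> \<zero>\<^bsub>A\<^esub>"
    using a_subset by (simp add: quotient_algebra_simps(4))
  show "abelian_group (quotient_algebra A I)"
  proof (rule abelian_groupI)
    fix K assume "K \<in> carrier (quotient_algebra A I)"
    then obtain x where "x \<in> carrier A" "K = I +>\<^bsub>A\<^esub> x"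
      by (auto simp: carrier_quotient)
    then show "\<exists>L\<in>carrier (quotient_algebra A I).
        L \<oplus>\<^bsub>quotient_algebra A I\<^esub> K = \<zero>\<^bsub>quotient_algebra A I\<^esub>"
      by (intro bexI[of _ "I +>\<^bsub>A\<^esub> \<ominus>\<^bsub>A\<^esub> x"])
        (simp_all add: zero carrier_quotient add_coset M.l_neg)
  qed (auto simp: zero carrier_quotient add_coset M.a_ac)
  show "monoid (quotient_algebra A I)"
    by (rule monoidI)
      (auto simp: carrier_quotient mult_coset quotient_algebra_simps(3) m_assoc)
qed (auto simp: carrier_quotient mult_coset add_coset l_distr r_distr)

lemma assoc_algebra_quotient: "assoc_algebra R (quotient_algebra A I)"
  by (rule assoc_algebraI[OF R.cring_axioms ring_quotient])
    (auto simp: carrier_quotient coset_simps smult_l_distr smult_r_distr smult_assoc1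
      smult_mult_left smult_mult_right)

lemma quotient_map_hom: "assoc_algebra_hom R A (quotient_algebra A I) (\<lambda>x. I +>\<^bsub>A\<^esub> x)"
  by (intro assoc_algebra_hom.intro assoc_algebra_axioms assoc_algebra_quotient
      assoc_algebra_hom_axioms.intro)
    (auto simp: ring_hom_def carrier_quotient coset_simps quotient_algebra_simps(3))

text \<open>Outside the carrier of the quotient the factored map is \<open>undefined\<close>, so that it is determined
  as a function by its values on cosets.\<close>

theorem factor_through_quotient:
  assumes "assoc_algebra_hom R A B h" and vanish: "\<And>x. x \<in> I \<Longrightarrow> h x = \<zero>\<^bsub>B\<^esub>"
  obtains k where "k \<in> extensional (carrier (quotient_algebra A I))"
    "assoc_algebra_hom R (quotient_algebra A I) B k"
    "\<And>x. x \<in> carrier A \<Longrightarrow> k (I +>\<^bsub>A\<^esub> x) = h x"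
proof -
  interpret h: assoc_algebra_hom R A B h by fact
  define k where "k = (\<lambda>K\<in>carrier (quotient_algebra A I). h (SOME x. x \<in> K))"
  have k: "k (I +>\<^bsub>A\<^esub> x) = h x" if x: "x \<in> carrier A" for x
  proof -
    \<comment> \<open>The chosen representative differs from \<open>x\<close> by an element of \<open>I\<close>, on which \<open>h\<close> vanishes.\<close>
    have "(SOME y. y \<in> I +>\<^bsub>A\<^esub> x) \<in> I +>\<^bsub>A\<^esub> x"
      using a_rcos_self[OF x] by (rule someI)
    then obtain i where "i \<in> I" "(SOME y. y \<in> I +>\<^bsub>A\<^esub> x) = i \<oplus>\<^bsub>A\<^esub> x"
      by (auto simp: a_r_coset_def r_coset_def)
    then show ?thesis
      using x by (simp add: k_def carrier_quotient h.hom_add vanish h.hom_closed)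
  qed
  show ?thesis
  proof
    show "assoc_algebra_hom R (quotient_algebra A I) B k"
      by (intro assoc_algebra_hom.intro assoc_algebra_quotient h.B.assoc_algebra_axioms
          assoc_algebra_hom_axioms.intro)
        (auto simp: ring_hom_def carrier_quotient coset_simps quotient_algebra_simps(3) k
          h.hom_closed h.hom_mult h.hom_add h.hom_one h.smult_hom)
    show "k \<in> extensional (carrier (quotient_algebra A I))"
      by (simp add: k_def)
  qed (rule k)
qed

end

section \<open>Monoid algebras\<close>

lemma monoid_algebra_simps:
  "carrier (monoid_algebra G) = {f. finite (supp f) \<and> supp f \<subseteq> carrier G}"
  "\<one>\<^bsub>monoid_algebra G\<^esub> = single \<one>\<^bsub>G\<^esub>"
  "\<zero>\<^bsub>monoid_algebra G\<^esub> = (\<lambda>x. 0)"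
  "f \<oplus>\<^bsub>monoid_algebra G\<^esub> g = (\<lambda>x. f x + g x)"
  "c \<odot>\<^bsub>monoid_algebra G\<^esub> f = (\<lambda>x. c * f x)"
  by (simp_all add: monoid_algebra_def)

lemma supp_single [simp]: "supp (single x) = {x}"
  by (auto simp: supp_def single_def)

lemma single_same [simp]: "single x x = 1"
  by (simp add: single_def)

lemma supp_add: "supp (\<lambda>x. f x + g x) \<subseteq> supp f \<union> supp g"
  by (auto simp: supp_def)

lemma supp_smult: "supp (\<lambda>x. c * f x) \<subseteq> supp f"
  by (auto simp: supp_def)

lemma single_closed: "x \<in> carrier G \<Longrightarrow> single x \<in> carrier (monoid_algebra G)"
  by (simp add: monoid_algebra_simps)

lemma monoid_algebra_add_closed:
  "\<lbrakk>f \<in> carrier (monoid_algebra G); g \<in> carrier (monoid_algebra G)\<rbrakk> \<Longrightarrow>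
    (\<lambda>x. f x + g x) \<in> carrier (monoid_algebra G)"
  using supp_add[of f g] by (auto simp: monoid_algebra_simps intro: finite_subset)

lemma monoid_algebra_smult_closed: "f \<in> carrier (monoid_algebra G) \<Longrightarrow> (\<lambda>x. c * f x) \<in> carrier (monoid_algebra G)"
  using supp_smult[of c f] by (auto simp: monoid_algebra_simps intro: finite_subset)

text \<open>The sums that define the convolution run over the supports, which change under addition;
  enlarging the index sets makes the product visibly bilinear.\<close>

lemma monoid_algebra_mult_superset:
  assumes "finite S" "supp f \<subseteq> S" "finite S'" "supp g \<subseteq> S'"
  shows "(f \<otimes>\<^bsub>monoid_algebra G\<^esub> g) x =
    (\<Sum>a\<in>S. \<Sum>b\<in>S'. if a \<otimes>\<^bsub>G\<^esub> b = x then f a * g b else 0)"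
proof -
  have "(f \<otimes>\<^bsub>monoid_algebra G\<^esub> g) x =
      (\<Sum>a\<in>supp f. \<Sum>b\<in>supp g. if a \<otimes>\<^bsub>G\<^esub> b = x then f a * g b else 0)"
    by (simp add: monoid_algebra_def)
  also have "\<dots> = (\<Sum>a\<in>supp f. \<Sum>b\<in>S'. if a \<otimes>\<^bsub>G\<^esub> b = x then f a * g b else 0)"
    using assms by (intro sum.cong sum.mono_neutral_left) (auto simp: supp_def)
  also have "\<dots> = (\<Sum>a\<in>S. \<Sum>b\<in>S'. if a \<otimes>\<^bsub>G\<^esub> b = x then f a * g b else 0)"
    using assms by (intro sum.mono_neutral_left) (auto simp: supp_def cong: if_cong)
  finally show ?thesis .
qed

lemma monoid_algebra_mult_add_left:
  assumes "f \<in> carrier (monoid_algebra G)" "f' \<in> carrier (monoid_algebra G)"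
    "g \<in> carrier (monoid_algebra G)"
  shows "(\<lambda>x. f x + f' x) \<otimes>\<^bsub>monoid_algebra G\<^esub> g =
    (\<lambda>x. (f \<otimes>\<^bsub>monoid_algebra G\<^esub> g) x + (f' \<otimes>\<^bsub>monoid_algebra G\<^esub> g) x)"
proof
  fix x
  have fin: "finite (supp f \<union> supp f')" "finite (supp g)"
    using assms by (auto simp: monoid_algebra_simps)
  show "((\<lambda>x. f x + f' x) \<otimes>\<^bsub>monoid_algebra G\<^esub> g) x =
      (f \<otimes>\<^bsub>monoid_algebra G\<^esub> g) x + (f' \<otimes>\<^bsub>monoid_algebra G\<^esub> g) x"
    using fin supp_add[of f f']
    by (simp add: monoid_algebra_mult_superset[of "supp f \<union> supp f'" _ "supp g"]
        sum.distrib[symmetric] distrib_right if_distrib cong: if_cong)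
qed

lemma monoid_algebra_mult_add_right:
  assumes "f \<in> carrier (monoid_algebra G)" "g \<in> carrier (monoid_algebra G)"
    "g' \<in> carrier (monoid_algebra G)"
  shows "f \<otimes>\<^bsub>monoid_algebra G\<^esub> (\<lambda>x. g x + g' x) =
    (\<lambda>x. (f \<otimes>\<^bsub>monoid_algebra G\<^esub> g) x + (f \<otimes>\<^bsub>monoid_algebra G\<^esub> g') x)"
proof
  fix x
  have fin: "finite (supp f)" "finite (supp g \<union> supp g')"
    using assms by (auto simp: monoid_algebra_simps)
  show "(f \<otimes>\<^bsub>monoid_algebra G\<^esub> (\<lambda>x. g x + g' x)) x =
      (f \<otimes>\<^bsub>monoid_algebra G\<^esub> g) x + (f \<otimes>\<^bsub>monoid_algebra G\<^esub> g') x"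
    using fin supp_add[of g g']
    by (simp add: monoid_algebra_mult_superset[of "supp f" _ "supp g \<union> supp g'"]
        sum.distrib[symmetric])
      (intro sum.cong refl; simp add: distrib_left)
qed

lemma monoid_algebra_mult_smult:
  assumes "f \<in> carrier (monoid_algebra G)" "g \<in> carrier (monoid_algebra G)"
  shows monoid_algebra_mult_smult_left: "(\<lambda>x. c * f x) \<otimes>\<^bsub>monoid_algebra G\<^esub> g =
      (\<lambda>x. c * (f \<otimes>\<^bsub>monoid_algebra G\<^esub> g) x)"
    and monoid_algebra_mult_smult_right: "f \<otimes>\<^bsub>monoid_algebra G\<^esub> (\<lambda>x. c * g x) =
      (\<lambda>x. c * (f \<otimes>\<^bsub>monoid_algebra G\<^esub> g) x)"
proof -
  have fin: "finite (supp f)" "finite (supp g)"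
    using assms by (auto simp: monoid_algebra_simps)
  note expand = monoid_algebra_mult_superset[OF fin(1) _ fin(2)]
  show "(\<lambda>x. c * f x) \<otimes>\<^bsub>monoid_algebra G\<^esub> g = (\<lambda>x. c * (f \<otimes>\<^bsub>monoid_algebra G\<^esub> g) x)"
    by (rule ext) (simp add: expand supp_smult sum_distrib_left if_distrib mult.assoc cong: if_cong)
  show "f \<otimes>\<^bsub>monoid_algebra G\<^esub> (\<lambda>x. c * g x) = (\<lambda>x. c * (f \<otimes>\<^bsub>monoid_algebra G\<^esub> g) x)"
    by (rule ext)
      (simp add: expand supp_smult sum_distrib_left if_distrib mult.left_commute cong: if_cong)
qed

lemma single_mult_single: "single x \<otimes>\<^bsub>monoid_algebra G\<^esub> single y = single (x \<otimes>\<^bsub>G\<^esub> y)"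
  by (rule ext, subst monoid_algebra_mult_superset[of "{x}" _ "{y}"]) (simp_all, simp add: single_def)

context monoid
begin

lemma monoid_algebra_mult_closed:
  assumes "f \<in> carrier (monoid_algebra G)" "g \<in> carrier (monoid_algebra G)"
  shows "f \<otimes>\<^bsub>monoid_algebra G\<^esub> g \<in> carrier (monoid_algebra G)"
proof -
  let ?P = "(\<lambda>(a, b). a \<otimes> b) ` (supp f \<times> supp g)"
  have fin: "finite (supp f)" "finite (supp g)"
    and sub: "supp f \<subseteq> carrier G" "supp g \<subseteq> carrier G"
    using assms by (auto simp: monoid_algebra_simps)
  have "supp (f \<otimes>\<^bsub>monoid_algebra G\<^esub> g) \<subseteq> ?P"
  proof
    fix x assume "x \<in> supp (f \<otimes>\<^bsub>monoid_algebra G\<^esub> g)"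
    then have "(\<Sum>a\<in>supp f. \<Sum>b\<in>supp g. if a \<otimes> b = x then f a * g b else 0) \<noteq> 0"
      by (simp add: supp_def monoid_algebra_mult_superset[OF fin(1) _ fin(2)])
    then obtain a where a: "a \<in> supp f" "(\<Sum>b\<in>supp g. if a \<otimes> b = x then f a * g b else 0) \<noteq> 0"
      by (rule sum.not_neutral_contains_not_neutral)
    from a(2) obtain b where "b \<in> supp g" "(if a \<otimes> b = x then f a * g b else 0) \<noteq> 0"
      by (rule sum.not_neutral_contains_not_neutral)
    then have "b \<in> supp g" "a \<otimes> b = x"
      by (auto split: if_splits)
    with a(1) show "x \<in> ?P" by force
  qed
  moreover have "finite ?P" "?P \<subseteq> carrier G"
    using fin sub by auto
  ultimately show ?thesis
    by (auto simp: monoid_algebra_simps intro: finite_subset)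
qed

text \<open>The basis elements span: an identity between expressions that are linear in \<open>f\<close> need only be
  checked for \<open>f = single x\<close>.\<close>

lemma monoid_algebra_induct [consumes 1, case_names single add smult]:
  assumes "f \<in> carrier (monoid_algebra G)"
    and single: "\<And>x. x \<in> carrier G \<Longrightarrow> P (single x)"
    and add: "\<And>f g. \<lbrakk>f \<in> carrier (monoid_algebra G); g \<in> carrier (monoid_algebra G); P f; P g\<rbrakk> \<Longrightarrow>
      P (\<lambda>x. f x + g x)"
    and smult: "\<And>c f. \<lbrakk>f \<in> carrier (monoid_algebra G); P f\<rbrakk> \<Longrightarrow> P (\<lambda>x. c * f x)"
  shows "P f"
proof -
  have "P f" if "finite S" "supp f \<subseteq> S" "S \<subseteq> carrier G" for f S
    using that
  proof (induction S arbitrary: f)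
    case empty
    then have "f = (\<lambda>x. 0 * single \<one> x)"
      by (auto simp: supp_def)
    then show ?case
      using smult[of "single \<one>" 0] single[of \<one>] by (simp add: single_closed)
  next
    case (insert a S)
    \<comment> \<open>Split off the coefficient at \<open>a\<close>.\<close>
    define g where "g = f(a := 0)"
    have g: "supp g \<subseteq> S"
      using insert.prems by (auto simp: g_def supp_def split: if_splits)
    have "f = (\<lambda>x. f a * single a x + g x)"
      by (auto simp: g_def single_def)
    moreover have "P g"
      by (rule insert.IH[OF g]) (use insert in auto)
    moreover have "g \<in> carrier (monoid_algebra G)"
      using g insert by (auto simp: monoid_algebra_simps intro: finite_subset)
    ultimately show ?case
      using add[of "\<lambda>x. f a * single a x" g] smult[of "single a" "f a"] single[of a] insert.prems
      by (simp add: single_closed monoid_algebra_smult_closed)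
  qed
  from this[of "supp f"] assms(1) show ?thesis
    by (auto simp: monoid_algebra_simps)
qed

lemmas monoid_algebra_linear =
  monoid_algebra_mult_add_left monoid_algebra_mult_add_right
  monoid_algebra_mult_smult_left monoid_algebra_mult_smult_right
  monoid_algebra_mult_closed single_closed monoid_algebra_add_closed monoid_algebra_smult_closed

text \<open>Both sides are trilinear, so associativity need only be checked on basis elements, where it is
  associativity in the monoid.\<close>

lemma monoid_algebra_assoc:
  assumes "f \<in> carrier (monoid_algebra G)" "g \<in> carrier (monoid_algebra G)"
    "h \<in> carrier (monoid_algebra G)"
  shows "f \<otimes>\<^bsub>monoid_algebra G\<^esub> g \<otimes>\<^bsub>monoid_algebra G\<^esub> h =
    f \<otimes>\<^bsub>monoid_algebra G\<^esub> (g \<otimes>\<^bsub>monoid_algebra G\<^esub> h)"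
proof -
  have 1: "single x \<otimes>\<^bsub>monoid_algebra G\<^esub> single y \<otimes>\<^bsub>monoid_algebra G\<^esub> h =
      single x \<otimes>\<^bsub>monoid_algebra G\<^esub> (single y \<otimes>\<^bsub>monoid_algebra G\<^esub> h)"
    if "x \<in> carrier G" "y \<in> carrier G" for x y
    using assms(3) by (induction h rule: monoid_algebra_induct)
      (use that in \<open>simp_all add: monoid_algebra_linear single_mult_single m_assoc\<close>)
  have 2: "single x \<otimes>\<^bsub>monoid_algebra G\<^esub> g \<otimes>\<^bsub>monoid_algebra G\<^esub> h =
      single x \<otimes>\<^bsub>monoid_algebra G\<^esub> (g \<otimes>\<^bsub>monoid_algebra G\<^esub> h)"
    if "x \<in> carrier G" for x
    using assms(2) by (induction g rule: monoid_algebra_induct)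
      (use that assms(3) in \<open>simp_all add: monoid_algebra_linear 1\<close>)
  show ?thesis
    using assms(1) by (induction f rule: monoid_algebra_induct)
      (use assms(2,3) in \<open>simp_all add: monoid_algebra_linear 2\<close>)
qed

theorem assoc_algebra_monoid_algebra: "assoc_algebra complex_field (monoid_algebra G)"
proof (rule assoc_algebraI[OF cring_from_type_algebra])
  have one_left: "single \<one> \<otimes>\<^bsub>monoid_algebra G\<^esub> f = f"
    and one_right: "f \<otimes>\<^bsub>monoid_algebra G\<^esub> single \<one> = f"
    if "f \<in> carrier (monoid_algebra G)" for f
    using that by (induction f rule: monoid_algebra_induct)
      (simp_all add: monoid_algebra_linear single_mult_single)
  show "ring (monoid_algebra G)"
  proof (rule ringI)
    show "abelian_group (monoid_algebra G)"
    proof (rule abelian_groupI)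
      fix f assume "f \<in> carrier (monoid_algebra G)"
      then show "\<exists>g\<in>carrier (monoid_algebra G). g \<oplus>\<^bsub>monoid_algebra G\<^esub> f = \<zero>\<^bsub>monoid_algebra G\<^esub>"
        by (intro bexI[of _ "\<lambda>x. (- 1) * f x"] monoid_algebra_smult_closed)
          (simp_all add: monoid_algebra_simps)
    next
      show "\<zero>\<^bsub>monoid_algebra G\<^esub> \<in> carrier (monoid_algebra G)"
        by (simp add: monoid_algebra_simps supp_def)
    qed (simp_all add: monoid_algebra_simps(4) monoid_algebra_add_closed monoid_algebra_simps(3)
      add.assoc add.commute add.left_commute)
    show "monoid (monoid_algebra G)"
      by (rule monoidI)
        (simp_all add: monoid_algebra_linear monoid_algebra_assoc monoid_algebra_simps(2)
          one_left one_right)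
  qed (simp_all add: monoid_algebra_simps(4) monoid_algebra_linear)
qed (simp_all add: monoid_algebra_simps(4,5) monoid_algebra_linear algebra_simps)

text \<open>A linear map on the monoid algebra is determined by its values on the basis.\<close>

lemma monoid_algebra_hom_eqI:
  assumes "assoc_algebra_hom complex_field (monoid_algebra G) B h"
    and "assoc_algebra_hom complex_field (monoid_algebra G) B k"
    and "\<And>x. x \<in> carrier G \<Longrightarrow> h (single x) = k (single x)"
    and "f \<in> carrier (monoid_algebra G)"
  shows "h f = k f"
proof -
  interpret h: assoc_algebra_hom complex_field "monoid_algebra G" B h by fact
  interpret k: assoc_algebra_hom complex_field "monoid_algebra G" B k by fact
  show ?thesis
    using assms(4)
  proof (induction f rule: monoid_algebra_induct)
    case (add f g)
    then show ?case
      using h.hom_add[of f g] k.hom_add[of f g] by (simp add: monoid_algebra_simps(4))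
  next
    case (smult c f)
    then show ?case
      using h.smult_hom[of c f] k.smult_hom[of c f] by (simp add: monoid_algebra_simps(5))
  qed (rule assms(3))
qed

text \<open>Both sides of \<open>h (f g) = h f h g\<close> are bilinear, so multiplicativity on the basis, which is the
  hypothesis on \<open>\<phi>\<close>, suffices.\<close>

theorem extend_monoid_hom:
  assumes "assoc_algebra complex_field B" and "\<phi> \<in> hom G B" and "\<phi> \<one> = \<one>\<^bsub>B\<^esub>"
  obtains h where "assoc_algebra_hom complex_field (monoid_algebra G) B h"
    "\<And>x. x \<in> carrier G \<Longrightarrow> h (single x) = \<phi> x"
proof -
  interpret B: assoc_algebra complex_field B by fact
  have \<phi>: "\<phi> x \<in> carrier B" if "x \<in> carrier G" for x
    using assms(2) that by (auto simp: hom_def)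
  define h where "h f = (\<Oplus>\<^bsub>B\<^esub>x\<in>supp f. f x \<odot>\<^bsub>B\<^esub> \<phi> x)" for f
  \<comment> \<open>A common index set makes the sums for \<open>f\<close>, \<open>g\<close> and \<open>f + g\<close> comparable.\<close>
  have h_superset: "h f = (\<Oplus>\<^bsub>B\<^esub>x\<in>S. f x \<odot>\<^bsub>B\<^esub> \<phi> x)"
    if "finite S" "supp f \<subseteq> S" "S \<subseteq> carrier G" for f S
    unfolding h_def using that \<phi>
    using B.smult_l_null by (intro B.add.finprod_mono_neutral_cong_left) (auto simp: supp_def)
  have h_closed: "h f \<in> carrier B" if "f \<in> carrier (monoid_algebra G)" for f
    using that \<phi> unfolding h_def by (intro B.finsum_closed) (auto simp: monoid_algebra_simps)
  have h_single: "h (single x) = \<phi> x" if "x \<in> carrier G" for x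
    using B.smult_one[OF \<phi>[OF that]] \<phi>[OF that] by (simp add: h_def)
  have h_add: "h (\<lambda>x. f x + g x) = h f \<oplus>\<^bsub>B\<^esub> h g"
    if "f \<in> carrier (monoid_algebra G)" "g \<in> carrier (monoid_algebra G)" for f g
  proof -
    let ?S = "supp f \<union> supp g"
    have S: "finite ?S" "?S \<subseteq> carrier G"
      using that by (auto simp: monoid_algebra_simps)
    have "h (\<lambda>x. f x + g x) = (\<Oplus>\<^bsub>B\<^esub>x\<in>?S. (f x + g x) \<odot>\<^bsub>B\<^esub> \<phi> x)"
      by (rule h_superset[OF S(1) supp_add S(2)])
    also have "\<dots> = (\<Oplus>\<^bsub>B\<^esub>x\<in>?S. f x \<odot>\<^bsub>B\<^esub> \<phi> x \<oplus>\<^bsub>B\<^esub> g x \<odot>\<^bsub>B\<^esub> \<phi> x)"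
      using S \<phi> B.smult_l_distr by (intro B.add.finprod_cong') (auto simp: subset_iff)
    also have "\<dots> = h f \<oplus>\<^bsub>B\<^esub> h g"
      using h_superset[of ?S f] h_superset[of ?S g] S \<phi> by (simp add: B.finsum_addf subset_iff Pi_def)
    finally show ?thesis .
  qed
  have h_smult: "h (\<lambda>x. c * f x) = c \<odot>\<^bsub>B\<^esub> h f" if "f \<in> carrier (monoid_algebra G)" for c f
  proof -
    have S: "finite (supp f)" "supp f \<subseteq> carrier G"
      using that by (auto simp: monoid_algebra_simps)
    have "h (\<lambda>x. c * f x) = (\<Oplus>\<^bsub>B\<^esub>x\<in>supp f. (c * f x) \<odot>\<^bsub>B\<^esub> \<phi> x)"
      by (rule h_superset[OF S(1) supp_smult S(2)])
    also have "\<dots> = (\<Oplus>\<^bsub>B\<^esub>x\<in>supp f. c \<odot>\<^bsub>B\<^esub> (f x \<odot>\<^bsub>B\<^esub> \<phi> x))"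
      using S \<phi> B.smult_assoc1 by (intro B.add.finprod_cong') (auto simp: subset_iff)
    also have "\<dots> = c \<odot>\<^bsub>B\<^esub> h f"
      unfolding h_def using S \<phi> by (intro B.finsum_smult_ldistr[symmetric]) auto
    finally show ?thesis .
  qed
  have h_single_mult: "h (single x \<otimes>\<^bsub>monoid_algebra G\<^esub> g) = h (single x) \<otimes>\<^bsub>B\<^esub> h g"
    if "x \<in> carrier G" "g \<in> carrier (monoid_algebra G)" for x g
    using that(2) by (induction g rule: monoid_algebra_induct)
      (use that(1) assms(2) \<phi> in \<open>simp_all add: monoid_algebra_linear single_mult_single h_single
        h_add h_smult h_closed hom_mult B.r_distr B.smult_mult_right\<close>)
  have h_mult: "h (f \<otimes>\<^bsub>monoid_algebra G\<^esub> g) = h f \<otimes>\<^bsub>B\<^esub> h g"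
    if "f \<in> carrier (monoid_algebra G)" "g \<in> carrier (monoid_algebra G)" for f g
    using that(1) by (induction f rule: monoid_algebra_induct)
      (use that(2) in \<open>simp_all add: monoid_algebra_linear h_single_mult
        h_add h_smult h_closed B.l_distr B.smult_mult_left\<close>)
  show ?thesis
  proof
    show "assoc_algebra_hom complex_field (monoid_algebra G) B h"
      by (intro assoc_algebra_hom.intro assoc_algebra_monoid_algebra assms(1)
          assoc_algebra_hom_axioms.intro)
        (simp_all add: ring_hom_def h_closed h_mult h_add h_smult h_single assms(3)
          monoid_algebra_simps(2,4,5))
  qed (rule h_single)
qed

end

section \<open>Algebras given by generators and relations\<close>

lemma free_monoid_simps [simp]:
  "carrier (free_monoid S) = lists S" "u \<otimes>\<^bsub>free_monoid S\<^esub> v = u @ v" "\<one>\<^bsub>free_monoid S\<^esub> = []"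
  by (simp_all add: free_monoid_def)

lemma monoid_free_monoid: "monoid (free_monoid S)"
  by (rule monoidI) auto

lemma assoc_algebra_free_algebra: "assoc_algebra complex_field (free_algebra S)"
  by (rule monoid.assoc_algebra_monoid_algebra[OF monoid_free_monoid])

definition word_value :: "('b, 'z) monoid_scheme \<Rightarrow> ('x \<Rightarrow> 'b) \<Rightarrow> 'x list \<Rightarrow> 'b" where
  "word_value B g w = foldr (\<otimes>\<^bsub>B\<^esub>) (map g w) \<one>\<^bsub>B\<^esub>"

lemma word_value_simps [simp]:
  "word_value B g [] = \<one>\<^bsub>B\<^esub>" "word_value B g (x # w) = g x \<otimes>\<^bsub>B\<^esub> word_value B g w"
  by (simp_all add: word_value_def)

lemma (in monoid) word_value_hom:
  assumes g: "\<And>x. x \<in> S \<Longrightarrow> g x \<in> carrier G"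
  shows "word_value G g \<in> hom (free_monoid S) G"
proof -
  have closed: "word_value G g w \<in> carrier G" if "w \<in> lists S" for w
    using that by (induction w) (auto simp: g)
  have "word_value G g (u @ v) = word_value G g u \<otimes> word_value G g v"
    if "u \<in> lists S" "v \<in> lists S" for u v
    using that by (induction u) (auto simp: g closed m_assoc)
  with closed show ?thesis
    by (auto simp: hom_def)
qed

text \<open>A morphism out of a free algebra is determined by the images of the generators, since words span
  and each word is a product of generators.\<close>

lemma hom_single_word:
  assumes "assoc_algebra_hom complex_field (free_algebra S) B h"
    and "\<And>x. x \<in> S \<Longrightarrow> h (single [x]) = g x" and w: "w \<in> lists S"
  shows "h (single w) = word_value B g w"
proof -
  interpret h: assoc_algebra_hom complex_field "free_algebra S" B h by fact
  show ?thesis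
    using w
  proof (induction w)
    case Nil
    then show ?case
      using h.hom_one by (simp add: monoid_algebra_simps(2))
  next
    case (Cons x w)
    have "single (x # w) = single [x] \<otimes>\<^bsub>free_algebra S\<^esub> single w"
      by (simp add: single_mult_single)
    then show ?case
      using Cons assms(2) by (simp add: h.hom_mult single_closed)
  qed
qed

lemma relations_closed:
  assumes "r \<subseteq> lists S \<times> lists S"
  shows "{single u \<ominus>\<^bsub>free_algebra S\<^esub> single v | u v. (u, v) \<in> r} \<subseteq> carrier (free_algebra S)"
proof -
  interpret assoc_algebra complex_field "free_algebra S"
    by (rule assoc_algebra_free_algebra)
  show ?thesis
    using assms by (auto intro!: M.minus_closed single_closed)
qed

text \<open>The morphism from the free algebra that extends \<open>g\<close> kills each difference of the two sides of a
  relation, hence the ideal that they generate. Composing with the quotient map reduces uniqueness to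
  the free algebra.\<close>

theorem presented_algebra_universal:
  assumes B: "assoc_algebra complex_field B"
    and g: "\<And>x. x \<in> S \<Longrightarrow> g x \<in> carrier B"
    and r: "r \<subseteq> lists S \<times> lists S"
    and relations: "\<And>u v. (u, v) \<in> r \<Longrightarrow> word_value B g u = word_value B g v"
  shows "\<exists>!\<psi>. \<psi> \<in> extensional (carrier (presented_algebra S r)) \<and>
    assoc_algebra_hom complex_field (presented_algebra S r) B \<psi> \<and>
    (\<forall>x\<in>S. \<psi> (presented_gen S r x) = g x)"
proof -
  let ?F = "free_algebra S" and ?I = "relation_ideal S r"
  interpret B: assoc_algebra complex_field B by (rule B)
  interpret F: assoc_algebra complex_field ?F by (rule assoc_algebra_free_algebra)
  interpret words: monoid "free_monoid S" by (rule monoid_free_monoid)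
  have "ideal ?I ?F"
    unfolding relation_ideal_def by (rule F.genideal_ideal[OF relations_closed[OF r]])
  then interpret algebra_ideal complex_field ?F ?I
    by (intro algebra_ideal.intro F.assoc_algebra_axioms)
  have "word_value B g \<in> hom (free_monoid S) B"
    by (rule B.word_value_hom[OF g])
  then obtain h where h: "assoc_algebra_hom complex_field ?F B h"
    and h_word: "\<And>w. w \<in> lists S \<Longrightarrow> h (single w) = word_value B g w"
    using words.extend_monoid_hom[OF B, of "word_value B g"] by auto
  interpret h: assoc_algebra_hom complex_field ?F B h by (rule h)
  interpret h: ring_hom_ring ?F B h
    by (rule ring_hom_ringI2[OF F.ring_axioms B.ring_axioms h.ring_hom])
  have "?I \<subseteq> a_kernel ?F B h"
    unfolding relation_ideal_def
  proof (rule F.genideal_minimal[OF h.kernel_is_ideal], clarify)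
    fix u v assume uv: "(u, v) \<in> r"
    then have words: "u \<in> lists S" "v \<in> lists S"
      using r by auto
    then have "h (single u) = h (single v)"
      using relations[OF uv] by (simp add: h_word)
    then have "h (single u \<ominus>\<^bsub>?F\<^esub> single v) = \<zero>\<^bsub>B\<^esub>"
      using words by (simp add: a_minus_def single_closed B.r_neg)
    moreover have "single u \<ominus>\<^bsub>?F\<^esub> single v \<in> carrier ?F"
      using words by (intro F.M.minus_closed single_closed) simp_all
    ultimately show "single u \<ominus>\<^bsub>?F\<^esub> single v \<in> a_kernel ?F B h"
      unfolding a_kernel_def' by blast
  qed
  then have "h f = \<zero>\<^bsub>B\<^esub>" if "f \<in> ?I" for f
    using that unfolding a_kernel_def' by blast
  then obtain \<psi> where \<psi>: "\<psi> \<in> extensional (carrier (quotient_algebra ?F ?I))"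
    "assoc_algebra_hom complex_field (quotient_algebra ?F ?I) B \<psi>"
    and \<psi>_h: "\<And>f. f \<in> carrier ?F \<Longrightarrow> \<psi> (?I +>\<^bsub>?F\<^esub> f) = h f"
    using factor_through_quotient[OF h] by metis
  show ?thesis
    unfolding presented_algebra_def presented_gen_def
  proof (rule ex1I[of _ \<psi>], intro conjI \<psi> ballI)
    fix x assume "x \<in> S"
    then show "\<psi> (?I +>\<^bsub>?F\<^esub> single [x]) = g x"
      using \<psi>_h[of "single [x]"] g by (simp add: single_closed h_word)
  next
    fix \<psi>'
    assume *: "\<psi>' \<in> extensional (carrier (quotient_algebra ?F ?I)) \<and>
      assoc_algebra_hom complex_field (quotient_algebra ?F ?I) B \<psi>' \<and>
      (\<forall>x\<in>S. \<psi>' (?I +>\<^bsub>?F\<^esub> single [x]) = g x)"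
    let ?k = "\<lambda>f. \<psi>' (?I +>\<^bsub>?F\<^esub> f)"
    have k: "assoc_algebra_hom complex_field ?F B ?k"
      using assoc_algebra_hom_compose[OF quotient_map_hom] * by blast
    have "?k (single w) = h (single w)" if "w \<in> lists S" for w
      using hom_single_word[OF k, of g w] * h_word that by simp
    then have "?k f = h f" if "f \<in> carrier ?F" for f
      using words.monoid_algebra_hom_eqI[OF k h] that by simp
    then show "\<psi>' = \<psi>"
      using * \<psi>(1) \<psi>_h by (intro extensionalityI[where A = "carrier (quotient_algebra ?F ?I)"])
        (auto simp: carrier_quotient)
  qed
qed

section \<open>The hyperoctahedral group\<close>

lemma monoid_semidirect_product:
  assumes "monoid N" "monoid H"
    and "\<And>g. g \<in> carrier H \<Longrightarrow> \<phi> g \<in> hom N N"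
    and "\<And>g. g \<in> carrier H \<Longrightarrow> \<phi> g \<one>\<^bsub>N\<^esub> = \<one>\<^bsub>N\<^esub>"
    and "\<And>x. x \<in> carrier N \<Longrightarrow> \<phi> \<one>\<^bsub>H\<^esub> x = x"
    and "\<And>g h x. \<lbrakk>g \<in> carrier H; h \<in> carrier H; x \<in> carrier N\<rbrakk> \<Longrightarrow> \<phi> (g \<otimes>\<^bsub>H\<^esub> h) x = \<phi> g (\<phi> h x)"
  shows "monoid (semidirect_product N H \<phi>)"
proof -
  interpret N: monoid N by fact
  interpret H: monoid H by fact
  have \<phi>: "\<phi> g x \<in> carrier N" "\<phi> g (x \<otimes>\<^bsub>N\<^esub> y) = \<phi> g x \<otimes>\<^bsub>N\<^esub> \<phi> g y"
    if "g \<in> carrier H" "x \<in> carrier N" "y \<in> carrier N" for g x y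
    using assms(3)[of g] that by (auto simp: hom_def)
  show ?thesis
    by (rule monoidI)
      (auto simp: semidirect_product_def \<phi> assms(4-6) N.m_assoc H.m_assoc)
qed

lemma C_group_simps:
  "carrier (C_group n) = ({1..n} \<rightarrow>\<^sub>E {0..<2})"
  "c \<otimes>\<^bsub>C_group n\<^esub> d = (\<lambda>k\<in>{1..n}. (c k + d k) mod 2)"
  "\<one>\<^bsub>C_group n\<^esub> = (\<lambda>k\<in>{1..n}. 0)"
  by (simp_all add: C_group_def carrier_integer_mod_group product_group_def)

lemma hyp_group_simps:
  "carrier (hyp_group n) = ({1..n} \<rightarrow>\<^sub>E {0..<2}) \<times> {\<sigma>. \<sigma> permutes {1..n}}"
  "(c, \<sigma>) \<otimes>\<^bsub>hyp_group n\<^esub> (d, \<tau>) =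
    (c \<otimes>\<^bsub>C_group n\<^esub> (\<lambda>k\<in>{1..n}. d (inv' \<sigma> k)), \<sigma> \<circ> \<tau>)"
  "\<one>\<^bsub>hyp_group n\<^esub> = (\<one>\<^bsub>C_group n\<^esub>, id)"
  by (simp_all add: hyp_group_def semidirect_product_def C_group_simps(1) sym_group_def)

lemma monoid_hyp_group: "monoid (hyp_group n)"
  unfolding hyp_group_def
proof (rule monoid_semidirect_product)
  show "monoid (C_group n)"
    unfolding C_group_def by (intro group.is_monoid) simp
  show "monoid (sym_group n)"
    using sym_group_is_group by (rule group.is_monoid)
next
  fix \<sigma> assume "\<sigma> \<in> carrier (sym_group n)"
  then have "inv' \<sigma> k \<in> {1..n} \<longleftrightarrow> k \<in> {1..n}" for k
    using permutes_in_image[OF permutes_inv] by (metis sym_group_carrier)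
  then show "(\<lambda>c. \<lambda>k\<in>{1..n}. c (inv' \<sigma> k)) \<in> hom (C_group n) (C_group n)"
    "(\<lambda>k\<in>{1..n}. \<one>\<^bsub>C_group n\<^esub> (inv' \<sigma> k)) = \<one>\<^bsub>C_group n\<^esub>"
    by (auto simp: hom_def C_group_simps PiE_iff fun_eq_iff)
next
  fix c assume "c \<in> carrier (C_group n)"
  then show "(\<lambda>k\<in>{1..n}. c (inv' \<one>\<^bsub>sym_group n\<^esub> k)) = c"
    by (auto simp: sym_group_def C_group_simps PiE_iff extensional_def fun_eq_iff)
next
  fix \<sigma> \<tau> c assume "\<sigma> \<in> carrier (sym_group n)" "\<tau> \<in> carrier (sym_group n)"
  then have \<sigma>: "\<sigma> permutes {1..n}" and \<tau>: "\<tau> permutes {1..n}"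
    by (simp_all add: sym_group_carrier)
  then have "inv' (\<sigma> \<circ> \<tau>) = inv' \<tau> \<circ> inv' \<sigma>"
    by (simp add: o_inv_distrib permutes_bij)
  moreover have "inv' \<sigma> k \<in> {1..n} \<longleftrightarrow> k \<in> {1..n}" for k
    using permutes_in_image[OF permutes_inv[OF \<sigma>]] .
  ultimately show "(\<lambda>k\<in>{1..n}. c (inv' (\<sigma> \<otimes>\<^bsub>sym_group n\<^esub> \<tau>) k)) =
      (\<lambda>k\<in>{1..n}. (\<lambda>k\<in>{1..n}. c (inv' \<tau> k)) (inv' \<sigma> k))"
    by (auto simp: sym_group_def fun_eq_iff)
qed

definition hyp_perm :: "nat \<Rightarrow> (nat \<Rightarrow> nat) \<Rightarrow> (nat \<Rightarrow> int) \<times> (nat \<Rightarrow> nat)" where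
  "hyp_perm n \<sigma> = (\<one>\<^bsub>C_group n\<^esub>, \<sigma>)"

text \<open>For \<open>i \<noteq> j\<close> this is the diagonal matrix \<open>t\<^sub>i t\<^sub>j\<close>; on the diagonal \<open>i = j\<close> it is \<open>t\<^sub>i\<close> and not
  \<open>t\<^sub>i\<^sup>2 = 1\<close>.\<close>

definition hyp_tt :: "nat \<Rightarrow> nat \<Rightarrow> nat \<Rightarrow> (nat \<Rightarrow> int) \<times> (nat \<Rightarrow> nat)" where
  "hyp_tt n i j = (\<lambda>k\<in>{1..n}. if k = i \<or> k = j then 1 else 0, id)"

lemma hyp_perm_closed: "\<sigma> \<in> carrier (sym_group n) \<Longrightarrow> hyp_perm n \<sigma> \<in> carrier (hyp_group n)"
  by (auto simp: hyp_perm_def hyp_group_simps C_group_simps sym_group_carrier)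

lemma hyp_tt_closed: "hyp_tt n i j \<in> carrier (hyp_group n)"
  by (auto simp: hyp_tt_def hyp_group_simps permutes_id)

lemma hyp_tt_sym: "hyp_tt n i j = hyp_tt n j i"
  by (auto simp: hyp_tt_def)

lemma hyp_t_mult:
  "\<lbrakk>i \<in> {1..n}; j \<in> {1..n}; i \<noteq> j\<rbrakk> \<Longrightarrow> hyp_t n i \<otimes>\<^bsub>hyp_group n\<^esub> hyp_t n j = hyp_tt n i j"
  by (auto simp: hyp_t_eq hyp_tt_def hyp_group_simps C_group_simps fun_eq_iff)

lemma hyp_tt_square: "hyp_tt n i j \<otimes>\<^bsub>hyp_group n\<^esub> hyp_tt n i j = \<one>\<^bsub>hyp_group n\<^esub>"
  by (auto simp: hyp_tt_def hyp_group_simps C_group_simps fun_eq_iff)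

lemma hyp_tt_commute:
  "hyp_tt n i j \<otimes>\<^bsub>hyp_group n\<^esub> hyp_tt n k l = hyp_tt n k l \<otimes>\<^bsub>hyp_group n\<^esub> hyp_tt n i j"
  by (auto simp: hyp_tt_def hyp_group_simps C_group_simps fun_eq_iff)

text \<open>The two factors \<open>t\<^sub>i\<close> cancel.\<close>

lemma hyp_tt_mult:
  "\<lbrakk>i \<noteq> j; i \<noteq> k; j \<noteq> k\<rbrakk> \<Longrightarrow> hyp_tt n i j \<otimes>\<^bsub>hyp_group n\<^esub> hyp_tt n i k = hyp_tt n j k"
  by (auto simp: hyp_tt_def hyp_group_simps C_group_simps fun_eq_iff)

lemma hyp_perm_id: "hyp_perm n id = \<one>\<^bsub>hyp_group n\<^esub>"
  by (simp add: hyp_perm_def hyp_group_simps)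

lemma hyp_perm_mult:
  "\<sigma> \<in> carrier (sym_group n) \<Longrightarrow> hyp_perm n \<sigma> \<otimes>\<^bsub>hyp_group n\<^esub> hyp_perm n \<tau> = hyp_perm n (\<sigma> \<circ> \<tau>)"
  using permutes_in_image[OF permutes_inv, of \<sigma> "{1..n}"] unfolding sym_group_carrier
  by (auto simp: hyp_perm_def hyp_group_simps C_group_simps fun_eq_iff)

text \<open>Conjugation by a permutation matrix moves the diagonal entry at \<open>i\<close> to \<open>\<sigma> i\<close>.\<close>

lemma hyp_perm_tt:
  assumes "\<sigma> \<in> carrier (sym_group n)"
  shows "hyp_perm n \<sigma> \<otimes>\<^bsub>hyp_group n\<^esub> hyp_tt n i j =
    hyp_tt n (\<sigma> i) (\<sigma> j) \<otimes>\<^bsub>hyp_group n\<^esub> hyp_perm n \<sigma>"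
proof -
  have \<sigma>: "\<sigma> permutes {1..n}"
    using assms by (simp only: sym_group_carrier)
  show ?thesis
    using permutes_in_image[OF permutes_inv[OF \<sigma>]] permutes_inv_eq[OF \<sigma>]
    by (auto simp: hyp_perm_def hyp_tt_def hyp_group_simps C_group_simps fun_eq_iff)
qed

section \<open>The images of the ties\<close>

text \<open>For an involution \<open>a\<close> this is the idempotent that projects onto the vectors fixed by \<open>a\<close>.\<close>

definition half_sum :: "('g, 'z) monoid_scheme \<Rightarrow> 'g \<Rightarrow> 'g \<Rightarrow> complex" where
  "half_sum G a = (1 / 2) \<odot>\<^bsub>monoid_algebra G\<^esub> (\<one>\<^bsub>monoid_algebra G\<^esub> \<oplus>\<^bsub>monoid_algebra G\<^esub> single a)"

text \<open>Naming the scalar keeps the function in the form of a scalar multiple, to which the bilinearity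
  of the product applies.\<close>

lemma half_sum_apply: "c = 1 / 2 \<Longrightarrow> half_sum G a = (\<lambda>x. c * (single \<one>\<^bsub>G\<^esub> x + single a x))"
  by (simp only: half_sum_def monoid_algebra_simps)

context monoid
begin

lemma half_sum_closed: "a \<in> carrier G \<Longrightarrow> half_sum G a \<in> carrier (monoid_algebra G)"
  unfolding half_sum_apply[OF refl]
  by (intro monoid_algebra_smult_closed monoid_algebra_add_closed single_closed one_closed)

lemma half_sum_mult:
  assumes "a \<in> carrier G" "b \<in> carrier G"
  shows "half_sum G a \<otimes>\<^bsub>monoid_algebra G\<^esub> half_sum G b =
    (\<lambda>x. 1 / 4 * (single \<one> x + single a x + single b x + single (a \<otimes> b) x))"
proof -
  define c :: complex where "c = 1 / 2"
  show ?thesis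
    unfolding half_sum_apply[OF c_def] using assms
    by (simp add: monoid_algebra_linear single_mult_single) (simp add: c_def field_simps)
qed

lemma half_sum_idem:
  "\<lbrakk>a \<in> carrier G; a \<otimes> a = \<one>\<rbrakk> \<Longrightarrow> half_sum G a \<otimes>\<^bsub>monoid_algebra G\<^esub> half_sum G a = half_sum G a"
  by (simp add: half_sum_mult) (simp add: half_sum_apply[OF refl] fun_eq_iff field_simps)

lemma half_sum_commute:
  "\<lbrakk>a \<in> carrier G; b \<in> carrier G; a \<otimes> b = b \<otimes> a\<rbrakk> \<Longrightarrow>
    half_sum G a \<otimes>\<^bsub>monoid_algebra G\<^esub> half_sum G b = half_sum G b \<otimes>\<^bsub>monoid_algebra G\<^esub> half_sum G a"
  by (simp add: half_sum_mult add_ac)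

text \<open>Expanding the products gives \<open>(1 + a + b + c) / 4\<close> on both sides.\<close>

lemma half_sum_absorb:
  "\<lbrakk>a \<in> carrier G; b \<in> carrier G; c \<in> carrier G; a \<otimes> b = c; a \<otimes> c = b\<rbrakk> \<Longrightarrow>
    half_sum G a \<otimes>\<^bsub>monoid_algebra G\<^esub> half_sum G b = half_sum G a \<otimes>\<^bsub>monoid_algebra G\<^esub> half_sum G c"
  by (simp add: half_sum_mult add_ac)

lemma single_half_sum:
  assumes "s \<in> carrier G" "a \<in> carrier G" "b \<in> carrier G" "s \<otimes> a = b \<otimes> s"
  shows "single s \<otimes>\<^bsub>monoid_algebra G\<^esub> half_sum G a = half_sum G b \<otimes>\<^bsub>monoid_algebra G\<^esub> single s"
proof -
  define c :: complex where "c = 1 / 2"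
  show ?thesis
    unfolding half_sum_apply[OF c_def] using assms
    by (simp add: monoid_algebra_linear single_mult_single)
qed

end

definition hyp_alg_perm :: "nat \<Rightarrow> (nat \<Rightarrow> nat) \<Rightarrow> (nat \<Rightarrow> int) \<times> (nat \<Rightarrow> nat) \<Rightarrow> complex" where
  "hyp_alg_perm n \<sigma> = single (hyp_perm n \<sigma>)"

text \<open>Ties between arbitrary strands \<open>i \<noteq> j\<close>: unlike the \<open>e\<^sub>i\<close> alone, they are permuted among each
  other under conjugation by all of the symmetric group.\<close>

definition hyp_tie :: "nat \<Rightarrow> nat \<Rightarrow> nat \<Rightarrow> (nat \<Rightarrow> int) \<times> (nat \<Rightarrow> nat) \<Rightarrow> complex" where
  "hyp_tie n i j = half_sum (hyp_group n) (hyp_tt n i j)"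

lemma single_hyp_s: "single (hyp_s n i) = hyp_alg_perm n (Transposition.transpose i (Suc i))"
  by (simp add: hyp_alg_perm_def hyp_s_def hyp_perm_def)

lemma hyp_e_eq: "i \<in> {1..<n} \<Longrightarrow> hyp_e n i = hyp_tie n i (Suc i)"
  by (simp add: hyp_e_def hyp_tie_def half_sum_def hyp_algebra_def hyp_t_mult)

lemma assoc_algebra_hyp_algebra: "assoc_algebra complex_field (hyp_algebra n)"
  unfolding hyp_algebra_def by (rule monoid.assoc_algebra_monoid_algebra[OF monoid_hyp_group])

lemma hyp_alg_perm_closed: "\<sigma> \<in> carrier (sym_group n) \<Longrightarrow> hyp_alg_perm n \<sigma> \<in> carrier (hyp_algebra n)"
  by (simp add: hyp_alg_perm_def hyp_algebra_def single_closed hyp_perm_closed)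

lemma hyp_tie_closed: "hyp_tie n i j \<in> carrier (hyp_algebra n)"
  by (simp add: hyp_tie_def hyp_algebra_def monoid.half_sum_closed[OF monoid_hyp_group] hyp_tt_closed)

lemma hyp_alg_perm_id: "hyp_alg_perm n id = \<one>\<^bsub>hyp_algebra n\<^esub>"
  by (simp add: hyp_alg_perm_def hyp_algebra_def hyp_perm_id monoid_algebra_simps(2))

lemma hyp_alg_perm_mult: "\<sigma> \<in> carrier (sym_group n) \<Longrightarrow>
    hyp_alg_perm n \<sigma> \<otimes>\<^bsub>hyp_algebra n\<^esub> hyp_alg_perm n \<tau> = hyp_alg_perm n (\<sigma> \<circ> \<tau>)"
  by (simp add: hyp_alg_perm_def hyp_algebra_def single_mult_single hyp_perm_mult)

lemma hyp_alg_perm_tie: "\<sigma> \<in> carrier (sym_group n) \<Longrightarrow>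
    hyp_alg_perm n \<sigma> \<otimes>\<^bsub>hyp_algebra n\<^esub> hyp_tie n i j =
    hyp_tie n (\<sigma> i) (\<sigma> j) \<otimes>\<^bsub>hyp_algebra n\<^esub> hyp_alg_perm n \<sigma>"
  unfolding hyp_alg_perm_def hyp_tie_def hyp_algebra_def
  by (intro monoid.single_half_sum[OF monoid_hyp_group] hyp_perm_closed hyp_tt_closed hyp_perm_tt)

lemma hyp_tie_sym: "hyp_tie n i j = hyp_tie n j i"
  by (simp add: hyp_tie_def hyp_tt_sym)

lemma hyp_tie_idem: "hyp_tie n i j \<otimes>\<^bsub>hyp_algebra n\<^esub> hyp_tie n i j = hyp_tie n i j"
  unfolding hyp_tie_def hyp_algebra_def
  by (intro monoid.half_sum_idem[OF monoid_hyp_group] hyp_tt_closed hyp_tt_square)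

lemma hyp_tie_commute:
  "hyp_tie n i j \<otimes>\<^bsub>hyp_algebra n\<^esub> hyp_tie n k l = hyp_tie n k l \<otimes>\<^bsub>hyp_algebra n\<^esub> hyp_tie n i j"
  unfolding hyp_tie_def hyp_algebra_def
  by (intro monoid.half_sum_commute[OF monoid_hyp_group] hyp_tt_closed hyp_tt_commute)

lemma hyp_tie_absorb:
  assumes "i \<noteq> j" "i \<noteq> k" "j \<noteq> k"
  shows "hyp_tie n i j \<otimes>\<^bsub>hyp_algebra n\<^esub> hyp_tie n i k = hyp_tie n i j \<otimes>\<^bsub>hyp_algebra n\<^esub> hyp_tie n j k"
  unfolding hyp_tie_def hyp_algebra_def
  using hyp_tt_mult[of i j k n] hyp_tt_mult[of j i k n] assms
  by (intro monoid.half_sum_absorb[OF monoid_hyp_group] hyp_tt_closed)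
    (simp_all add: hyp_tt_sym[of n j i])

text \<open>The transposition \<open>s\<^sub>j\<close> replaces the end of the tie \<open>{i, i + 1}\<close> that it shares with \<open>{j, j + 1}\<close> by
  the other end of the latter. So the three ties form a triangle, and the absorption rule applies.\<close>

lemma adjacent_tie_absorb:
  assumes "adjacent i j"
  defines "s \<equiv> Transposition.transpose j (Suc j)"
  shows "hyp_tie n i (Suc i) \<otimes>\<^bsub>hyp_algebra n\<^esub> hyp_tie n (s i) (s (Suc i)) =
    hyp_tie n i (Suc i) \<otimes>\<^bsub>hyp_algebra n\<^esub> hyp_tie n j (Suc j)"
proof -
  consider "j = Suc i" | "i = Suc j"
    using assms(1) by linarith
  then show ?thesis
  proof cases
    case 1
    then show ?thesis
      using hyp_tie_absorb[of i "Suc i" "Suc (Suc i)" n] by (simp add: s_def transpose_def)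
  next
    case 2
    then show ?thesis
      using hyp_tie_absorb[of i "Suc i" j n]
      by (simp add: s_def transpose_def hyp_tie_sym[of n j])
  qed
qed

definition bt_image :: "nat \<Rightarrow> bt_gen \<Rightarrow> (nat \<Rightarrow> int) \<times> (nat \<Rightarrow> nat) \<Rightarrow> complex" where
  "bt_image n x = (case x of
     T i \<Rightarrow> hyp_alg_perm n (Transposition.transpose i (Suc i)) | E i \<Rightarrow> hyp_tie n i (Suc i))"

lemma transpose_in_sym_group:
  "i \<in> {1..<n} \<Longrightarrow> Transposition.transpose i (Suc i) \<in> carrier (sym_group n)"
  unfolding sym_group_carrier by (rule permutes_swap_id) auto

lemma comp_in_sym_group:
  "\<lbrakk>\<sigma> \<in> carrier (sym_group n); \<tau> \<in> carrier (sym_group n)\<rbrakk> \<Longrightarrow> \<sigma> \<circ> \<tau> \<in> carrier (sym_group n)"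
  unfolding sym_group_carrier by (rule permutes_compose)

lemma bt_image_closed: "x \<in> bt_gens n \<Longrightarrow> bt_image n x \<in> carrier (hyp_algebra n)"
  by (auto simp: bt_image_def bt_gens_def hyp_alg_perm_closed hyp_tie_closed transpose_in_sym_group)

text \<open>Relations in the \<open>T\<^sub>i\<close> reduce to identities of permutations; in the mixed ones the permutations are
  moved past the ties, which leaves identities between products of ties.\<close>

lemma bt_image_relation:
  assumes "(u, v) \<in> bt_relations n"
  shows "word_value (hyp_algebra n) (bt_image n) u = word_value (hyp_algebra n) (bt_image n) v"
proof -
  let ?A = "hyp_algebra n" and ?s = "\<lambda>i. Transposition.transpose i (Suc i)"
  interpret assoc_algebra complex_field ?A by (rule assoc_algebra_hyp_algebra)
  note closed = hyp_alg_perm_closed hyp_tie_closed comp_in_sym_group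
  note rules = bt_image_def closed transpose_in_sym_group hyp_alg_perm_mult hyp_tie_commute
  show ?thesis
    using assms
  proof cases
    case (TT_far i j)
    then have "?s i \<circ> ?s j = ?s j \<circ> ?s i"
      by (auto simp: fun_eq_iff transpose_def)
    then show ?thesis
      using TT_far by (simp add: rules)
  next
    case (TTT i j)
    then have "j = Suc i \<or> i = Suc j"
      by linarith
    then have "?s i \<circ> (?s j \<circ> ?s i) = ?s j \<circ> (?s i \<circ> ?s j)"
      by (auto simp: fun_eq_iff transpose_def)
    then show ?thesis
      using TTT by (simp add: rules)
  next
    case (EE_idem i)
    then show ?thesis
      by (simp add: bt_image_def closed hyp_tie_idem)
  next
    case (EE i j)
    then show ?thesis
      by (simp add: bt_image_def closed hyp_tie_commute[of n j])
  next
    case (ET i)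
    then show ?thesis
      by (simp add: bt_image_def closed transpose_in_sym_group hyp_alg_perm_tie hyp_tie_sym[of n "Suc i"])
  next
    case (ET_far i j)
    then have "?s j i = i" "?s j (Suc i) = Suc i"
      by (auto simp: transpose_def)
    with ET_far show ?thesis
      by (simp add: bt_image_def closed transpose_in_sym_group hyp_alg_perm_tie)
  next
    case (ETT i j)
    then have "j = Suc i \<or> i = Suc j"
      by linarith
    \<comment> \<open>The product \<open>s\<^sub>i s\<^sub>j\<close> carries the tie \<open>{i, i + 1}\<close> to \<open>{j, j + 1}\<close>.\<close>
    then have "(?s i \<circ> ?s j) i = j" "(?s i \<circ> ?s j) (Suc i) = Suc j"
      by (auto simp: transpose_def)
    then have "hyp_alg_perm n (?s i \<circ> ?s j) \<otimes>\<^bsub>?A\<^esub> hyp_tie n i (Suc i) =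
        hyp_tie n j (Suc j) \<otimes>\<^bsub>?A\<^esub> hyp_alg_perm n (?s i \<circ> ?s j)"
      using ETT by (simp only: hyp_alg_perm_tie comp_in_sym_group transpose_in_sym_group)
    then show ?thesis
      using ETT by (simp add: bt_image_def closed transpose_in_sym_group hyp_alg_perm_mult flip: m_assoc)
  next
    case (EET_ETE i j)
    then show ?thesis
      using adjacent_tie_absorb[of i j n]
      by (simp add: bt_image_def closed transpose_in_sym_group hyp_alg_perm_tie flip: m_assoc)
  next
    case (ETE_TEE i j)
    \<comment> \<open>Since \<open>s\<^sub>j\<close> is an involution, it moves past a tie to the left by the same rule as to the right.\<close>
    have "hyp_tie n i (Suc i) \<otimes>\<^bsub>?A\<^esub> hyp_alg_perm n (?s j) =
        hyp_alg_perm n (?s j) \<otimes>\<^bsub>?A\<^esub> hyp_tie n (?s j i) (?s j (Suc i))"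
      using ETE_TEE by (simp add: hyp_alg_perm_tie transpose_in_sym_group)
    then have "hyp_tie n i (Suc i) \<otimes>\<^bsub>?A\<^esub> hyp_alg_perm n (?s j) \<otimes>\<^bsub>?A\<^esub> hyp_tie n i (Suc i) =
        hyp_alg_perm n (?s j) \<otimes>\<^bsub>?A\<^esub> (hyp_tie n i (Suc i) \<otimes>\<^bsub>?A\<^esub> hyp_tie n (?s j i) (?s j (Suc i)))"
      using ETE_TEE
      by (simp add: closed transpose_in_sym_group m_assoc hyp_tie_commute[of n _ _ i "Suc i"])
    then show ?thesis
      using ETE_TEE adjacent_tie_absorb[of i j n]
      by (simp add: bt_image_def closed transpose_in_sym_group m_assoc)
  next
    case (TT i)
    then show ?thesis
      by (simp add: bt_image_def closed transpose_in_sym_group hyp_alg_perm_mult hyp_alg_perm_id)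
  qed
qed

lemma bt_relations_words: "bt_relations n \<subseteq> lists (bt_gens n) \<times> lists (bt_gens n)"
  by (auto simp: bt_gens_def elim!: bt_relations.cases)

theorem proposition8:
  fixes n :: nat
  shows "\<exists>!\<psi>. \<psi> \<in> extensional (carrier (bt_algebra n)) \<and>
    assoc_algebra_hom complex_field (bt_algebra n) (hyp_algebra n) \<psi> \<and>
    (\<forall>i\<in>{1..<n}. \<psi> (bt_T n i) = single (hyp_s n i) \<and> \<psi> (bt_E n i) = hyp_e n i)"
proof -
  have "(\<forall>x\<in>bt_gens n. \<psi> (presented_gen (bt_gens n) (bt_relations n) x) = bt_image n x) \<longleftrightarrow>
      (\<forall>i\<in>{1..<n}. \<psi> (bt_T n i) = single (hyp_s n i) \<and> \<psi> (bt_E n i) = hyp_e n i)" for \<psi>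
    by (auto simp: bt_image_def bt_T_def bt_E_def single_hyp_s hyp_e_eq bt_gens_def)
  then show ?thesis
    using presented_algebra_universal[where S = "bt_gens n" and r = "bt_relations n",
        OF assoc_algebra_hyp_algebra[of n] bt_image_closed bt_relations_words bt_image_relation]
    unfolding bt_algebra_def by simp
qed

end
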